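(* Let $n \ge 1$ be an integer and let $A, B, C, D$ be pairwise disjoint sets with $|A| = |C| = n+1$ and $|B| = |D| = n$. Let $L = A \cup B$ and $R = C \cup D$, and let $X = (L, R, E)$ be the bipartite graph with parts $L$ and $R$ whose edge set $E$ is the union of a perfect matching between $A$ and $C$, the set of all edges between $A$ and $D$, and the set of all edges between $B$ and $C$. Then $X$ is $(n+1)$-regular, and the set $A \cup C$ has size $2(n+1) = |L| + 1$ and induces a subgraph of $X$ with maximum degree $1$. In particular, there is a regular bipartite graph $X=(L,R,E)$ with a subset of $|L|+1$ vertices inducing a subgraph of maximum degree $1$.
   Context: All graphs are finite, simple and undirected. The subgraph induced by a vertex subset $W$ has vertex set $W$ and all edges of $X$ with both endpoints in $W$. *)

theory Defs
  imports "Graph_Theory.Digraph_Component" "Graph_Theory.Pair_Digraph"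
begin

text \<open>
  As in the library, a finite simple undirected graph is a finite symmetric digraph without loops
  and parallel arcs (locale \<^locale>\<open>graph\<close>): an edge \<open>uv\<close> is the pair of arcs \<open>(u, v)\<close>, \<open>(v, u)\<close>.
  Hence the number of edges at a vertex is its \<^const>\<open>out_degree\<close>.
\<close>

definition degree :: "('a, 'b) pre_digraph \<Rightarrow> 'a \<Rightarrow> nat" where
  "degree G v = out_degree G v"

definition regular :: "nat \<Rightarrow> ('a, 'b) pre_digraph \<Rightarrow> bool" where
  "regular k G \<longleftrightarrow> (\<forall>v \<in> verts G. degree G v = k)"

text \<open>Only meaningful when \<^term>\<open>verts G\<close> is finite and nonempty.\<close>

definition max_degree :: "('a, 'b) pre_digraph \<Rightarrow> nat" where
  "max_degree G = Max (degree G ` verts G)"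

definition bipartite_graph :: "'a set \<Rightarrow> 'a set \<Rightarrow> ('a, 'b) pre_digraph \<Rightarrow> bool" where
  "bipartite_graph L R G \<longleftrightarrow>
     graph G \<and> verts G = L \<union> R \<and> L \<inter> R = {} \<and>
     (\<forall>u v. u \<rightarrow>\<^bsub>G\<^esub> v \<longrightarrow> (u \<in> L \<and> v \<in> R) \<or> (u \<in> R \<and> v \<in> L))"

text \<open>Each matching edge is recorded once, oriented from \<open>A\<close> to \<open>C\<close>.\<close>

definition perfect_matching_between :: "'a set \<Rightarrow> 'a set \<Rightarrow> ('a \<times> 'a) set \<Rightarrow> bool" where
  "perfect_matching_between A C M \<longleftrightarrow>
     M \<subseteq> A \<times> C \<and>
     (\<forall>a \<in> A. \<exists>!c. (a, c) \<in> M) \<and>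
     (\<forall>c \<in> C. \<exists>!a. (a, c) \<in> M)"

definition undirected_graph :: "'a set \<Rightarrow> ('a \<times> 'a) set \<Rightarrow> ('a, 'a \<times> 'a) pre_digraph" where
  "undirected_graph V E = with_proj \<lparr> pverts = V, parcs = E \<union> E\<inverse> \<rparr>"

end

theory Submission
  imports Defs
begin

text \<open>
  Every degree is the size of a neighbourhood, and all neighbourhoods are explicit. A vertex
  \<open>a \<in> A\<close> is adjacent to its partner in \<open>C\<close> and to all of \<open>D\<close>, a vertex \<open>b \<in> B\<close> to all of \<open>C\<close>, and
  symmetrically for \<open>C\<close> and \<open>D\<close>; so every degree is \<open>n + 1\<close>. In \<open>A \<union> C\<close> only the matching
  edges survive, so there every vertex has exactly one neighbour
  (\<open>matching_blowup_neighbours\<close>, \<open>matching_blowup_properties\<close>). Four consecutive intervals of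
  natural numbers, with the shift by \<open>n + 1\<close> as the matching, give a concrete instance.
\<close>

lemma undirected_graph_simps [simp]:
  "verts (undirected_graph V E) = V"
  "arcs (undirected_graph V E) = E \<union> E\<inverse>"
  "tail (undirected_graph V E) = fst"
  "head (undirected_graph V E) = snd"
  "arcs_ends (undirected_graph V E) = E \<union> E\<inverse>"
  by (simp_all add: undirected_graph_def)

lemma degree_undirected_graph:
  "degree (undirected_graph V E) v = card ((E \<union> E\<inverse>) `` {v})"
proof -
  have "out_arcs (undirected_graph V E) v = Pair v ` ((E \<union> E\<inverse>) `` {v})"
    by (auto simp: out_arcs_def)
  then show ?thesis
    by (simp add: degree_def out_degree_def card_image inj_on_def)
qed

lemma degree_induced_undirected_graph:
  assumes "v \<in> W"
  shows "degree (undirected_graph V E \<restriction> W) v = card ((E \<union> E\<inverse>) `` {v} \<inter> W)"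
proof -
  have "out_arcs (undirected_graph V E \<restriction> W) v = Pair v ` ((E \<union> E\<inverse>) `` {v} \<inter> W)"
    using assms by (auto simp: out_arcs_def)
  then show ?thesis
    by (simp add: degree_def out_degree_def card_image inj_on_def)
qed

lemma bipartite_undirected_graph:
  assumes "finite L" "finite R" "L \<inter> R = {}" "E \<subseteq> L \<times> R"
  shows "bipartite_graph L R (undirected_graph (L \<union> R) E)"
proof -
  let ?X = "undirected_graph (L \<union> R) E"
  have "finite E"
    using assms finite_subset by blast
  then have "graph ?X"
    using assms
    by unfold_locales (auto simp: arc_to_ends_def symmetric_def intro: symI)
  then show ?thesis
    using assms by (auto simp: bipartite_graph_def)
qed

lemma perfect_matching_between_bij:
  assumes "bij_betw f A C"
  shows "perfect_matching_between A C ((\<lambda>a. (a, f a)) ` A)"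
  using assms unfolding perfect_matching_between_def bij_betw_def inj_on_def by blast

text \<open>
  \<open>N\<close> is the symmetric adjacency relation. In the cases \<open>A\<close> and \<open>C\<close> the witness is the partner under
  the matching \<open>M\<close>; its identity does not matter for counting degrees.
\<close>

lemma matching_blowup_neighbours:
  assumes disj: "A \<inter> B = {}" "A \<inter> C = {}" "A \<inter> D = {}" "B \<inter> C = {}" "B \<inter> D = {}" "C \<inter> D = {}"
    and M: "perfect_matching_between A C M"
  defines "N \<equiv> (M \<union> A \<times> D \<union> B \<times> C) \<union> (M \<union> A \<times> D \<union> B \<times> C)\<inverse>"
  shows "a \<in> A \<Longrightarrow> \<exists>c \<in> C. N `` {a} = insert c D"
    and "b \<in> B \<Longrightarrow> N `` {b} = C"
    and "c \<in> C \<Longrightarrow> \<exists>a \<in> A. N `` {c} = insert a B"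
    and "d \<in> D \<Longrightarrow> N `` {d} = A"
proof -
  have "M \<subseteq> A \<times> C"
    using M by (simp add: perfect_matching_between_def)
  then have M_in: "x \<in> A" "y \<in> C" if "(x, y) \<in> M" for x y
    using that by auto
  have N: "N `` {x} = {y. (x, y) \<in> M \<or> (y, x) \<in> M \<or> x \<in> A \<and> y \<in> D \<or> y \<in> A \<and> x \<in> D
      \<or> x \<in> B \<and> y \<in> C \<or> y \<in> B \<and> x \<in> C}" for x
    unfolding N_def by blast
  show "\<exists>c \<in> C. N `` {a} = insert c D" if a: "a \<in> A"
  proof -
    obtain c where c: "(a, c) \<in> M" and uniq: "\<And>c'. (a, c') \<in> M \<Longrightarrow> c' = c"
      using M a unfolding perfect_matching_between_def by metis
    have "a \<notin> B" "a \<notin> C" "a \<notin> D"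
      using a disj by blast+
    then have "N `` {a} = insert c D"
      unfolding N using a c by (auto dest: uniq M_in)
    then show ?thesis
      using M_in(2)[OF c] by blast
  qed
  show "\<exists>a \<in> A. N `` {c} = insert a B" if c: "c \<in> C"
  proof -
    obtain a where a: "(a, c) \<in> M" and uniq: "\<And>a'. (a', c) \<in> M \<Longrightarrow> a' = a"
      using M c unfolding perfect_matching_between_def by metis
    have "c \<notin> A" "c \<notin> B" "c \<notin> D"
      using c disj by blast+
    then have "N `` {c} = insert a B"
      unfolding N using c a by (auto dest: uniq M_in)
    then show ?thesis
      using M_in(1)[OF a] by blast
  qed
  show "N `` {b} = C" if b: "b \<in> B"
  proof -
    have "b \<notin> A" "b \<notin> C" "b \<notin> D"
      using b disj by blast+
    then show ?thesis
      unfolding N using b by (auto dest: M_in)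
  qed
  show "N `` {d} = A" if d: "d \<in> D"
  proof -
    have "d \<notin> A" "d \<notin> B" "d \<notin> C"
      using d disj by blast+
    then show ?thesis
      unfolding N using d by (auto dest: M_in)
  qed
qed

text \<open>
  Finiteness is assumed because \<^const>\<open>card\<close> is \<open>0\<close> on infinite sets; with it, the construction
  also works for \<open>n = 0\<close>.
\<close>

lemma matching_blowup_properties:
  assumes disj: "A \<inter> B = {}" "A \<inter> C = {}" "A \<inter> D = {}" "B \<inter> C = {}" "B \<inter> D = {}" "C \<inter> D = {}"
    and fin: "finite A" "finite B" "finite C" "finite D"
    and card: "card A = n + 1" "card C = n + 1" "card B = n" "card D = n"
    and M: "perfect_matching_between A C M"
  defines "X \<equiv> undirected_graph ((A \<union> B) \<union> (C \<union> D)) (M \<union> A \<times> D \<union> B \<times> C)"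
  shows "bipartite_graph (A \<union> B) (C \<union> D) X"
    and "regular (n + 1) X"
    and "max_degree (X \<restriction> (A \<union> C)) = 1"
proof -
  note nbrs = matching_blowup_neighbours[OF disj M]
  have "M \<subseteq> A \<times> C"
    using M by (simp add: perfect_matching_between_def)
  then show "bipartite_graph (A \<union> B) (C \<union> D) X"
    unfolding X_def using disj fin by (intro bipartite_undirected_graph) auto
  have "degree X v = n + 1" if v: "v \<in> (A \<union> B) \<union> (C \<union> D)" for v
  proof -
    consider "v \<in> A" | "v \<in> B" | "v \<in> C" | "v \<in> D"
      using v by blast
    then show ?thesis
    proof cases
      case 1
      then obtain c where "c \<in> C"
        and "degree X v = card (insert c D)"
        unfolding X_def degree_undirected_graph using nbrs(1) by metis
      then show ?thesis
        using disj fin card by (simp add: disjoint_iff)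
    next
      case 2
      then show ?thesis
        unfolding X_def degree_undirected_graph using nbrs(2) card by metis
    next
      case 3
      then obtain a where "a \<in> A"
        and "degree X v = card (insert a B)"
        unfolding X_def degree_undirected_graph using nbrs(3) by metis
      then show ?thesis
        using disj fin card by (simp add: disjoint_iff)
    next
      case 4
      then show ?thesis
        unfolding X_def degree_undirected_graph using nbrs(4) card by metis
    qed
  qed
  then show "regular (n + 1) X"
    by (simp add: regular_def X_def)
  have deg1: "degree (X \<restriction> (A \<union> C)) v = 1" if v: "v \<in> A \<union> C" for v
  proof -
    have ins: "insert c D \<inter> (A \<union> C) = {c}" if "c \<in> C" for c
      using that disj by blast
    have ins': "insert a B \<inter> (A \<union> C) = {a}" if "a \<in> A" for a
      using that disj by blast
    from v show ?thesis
    proof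
      assume "v \<in> A"
      then obtain c where "c \<in> C"
        and "degree (X \<restriction> (A \<union> C)) v = card (insert c D \<inter> (A \<union> C))"
        unfolding X_def degree_induced_undirected_graph[OF v] using nbrs(1) by metis
      then show ?thesis
        by (simp only: ins) simp
    next
      assume "v \<in> C"
      then obtain a where "a \<in> A"
        and "degree (X \<restriction> (A \<union> C)) v = card (insert a B \<inter> (A \<union> C))"
        unfolding X_def degree_induced_undirected_graph[OF v] using nbrs(3) by metis
      then show ?thesis
        by (simp only: ins') simp
    qed
  qed
  have "A \<noteq> {}"
    using card by auto
  then have "degree (X \<restriction> (A \<union> C)) ` (A \<union> C) = {1}"
    using deg1 by auto
  then show "max_degree (X \<restriction> (A \<union> C)) = 1"
    by (simp add: max_degree_def)
qed

theorem mainTheorem3: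
  fixes n :: nat
  assumes "n \<ge> 1"
  shows "(\<forall>(A :: 'a set) B C D M L R X.
            A \<inter> B = {} \<and> A \<inter> C = {} \<and> A \<inter> D = {} \<and> B \<inter> C = {} \<and> B \<inter> D = {} \<and> C \<inter> D = {} \<and>
            card A = n + 1 \<and> card C = n + 1 \<and> card B = n \<and> card D = n \<and>
            L = A \<union> B \<and> R = C \<union> D \<and>
            perfect_matching_between A C M \<and>
            X = undirected_graph (L \<union> R) (M \<union> A \<times> D \<union> B \<times> C)
          \<longrightarrow>
            bipartite_graph L R X \<and>
            regular (n + 1) X \<and>
            card (A \<union> C) = 2 * (n + 1) \<and> 2 * (n + 1) = card L + 1 \<and>
            max_degree (X \<restriction> (A \<union> C)) = 1)
       \<and> (\<exists>(X :: (nat, nat \<times> nat) pre_digraph) L R W.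
            bipartite_graph L R X \<and> regular (n + 1) X \<and>
            W \<subseteq> verts X \<and> card W = card L + 1 \<and>
            max_degree (X \<restriction> W) = 1)"
proof (intro conjI allI impI; (elim conjE)?)
  fix A B C D :: "'a set" and M L R X
  assume disj: "A \<inter> B = {}" "A \<inter> C = {}" "A \<inter> D = {}" "B \<inter> C = {}" "B \<inter> D = {}" "C \<inter> D = {}"
    and card: "card A = n + 1" "card C = n + 1" "card B = n" "card D = n"
    and LR: "L = A \<union> B" "R = C \<union> D"
    and M: "perfect_matching_between A C M"
    and X: "X = undirected_graph (L \<union> R) (M \<union> A \<times> D \<union> B \<times> C)"
  \<comment> \<open>This is where \<open>n \<ge> 1\<close> enters: \<open>B\<close> and \<open>D\<close> have nonzero cardinality.\<close>
  have fin: "finite A" "finite B" "finite C" "finite D"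
    using card assms by (auto intro: card_ge_0_finite)
  show "bipartite_graph L R X" "regular (n + 1) X" "max_degree (X \<restriction> (A \<union> C)) = 1"
    unfolding X LR by (fact matching_blowup_properties[OF disj fin card M])+
  show "card (A \<union> C) = 2 * (n + 1)" "2 * (n + 1) = card L + 1"
    unfolding LR using disj fin card by (simp_all add: card_Un_disjoint)
next
  define A B C D :: "nat set"
    where "A = {0..<n + 1}" and "B = {2 * n + 2..<3 * n + 2}"
      and "C = {n + 1..<2 * n + 2}" and "D = {3 * n + 2..<4 * n + 2}"
  note defs = A_def B_def C_def D_def
  define M where "M = (\<lambda>a. (a, a + (n + 1))) ` A"
  have disj: "A \<inter> B = {}" "A \<inter> C = {}" "A \<inter> D = {}" "B \<inter> C = {}" "B \<inter> D = {}" "C \<inter> D = {}"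
    by (auto simp: defs)
  have fin: "finite A" "finite B" "finite C" "finite D"
    by (simp_all add: defs)
  have card: "card A = n + 1" "card C = n + 1" "card B = n" "card D = n"
    by (simp_all add: defs)
  have "(\<lambda>a. a + (n + 1)) ` A = C"
    unfolding defs image_add_atLeastLessThan' by (simp add: mult_2)
  then have "bij_betw (\<lambda>a. a + (n + 1)) A C"
    by (simp add: bij_betw_def inj_on_def)
  then have M: "perfect_matching_between A C M"
    unfolding M_def by (rule perfect_matching_between_bij)
  let ?X = "undirected_graph ((A \<union> B) \<union> (C \<union> D)) (M \<union> A \<times> D \<union> B \<times> C)"
  have "A \<union> C \<subseteq> verts ?X"
    by auto
  moreover have "card (A \<union> C) = card (A \<union> B) + 1"
    using disj fin card by (simp add: card_Un_disjoint)
  ultimately show "\<exists>(X :: (nat, nat \<times> nat) pre_digraph) L R W.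
            bipartite_graph L R X \<and> regular (n + 1) X \<and>
            W \<subseteq> verts X \<and> card W = card L + 1 \<and>
            max_degree (X \<restriction> W) = 1"
    using matching_blowup_properties[OF disj fin card M] by blast
qed

end
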